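(* Let $X_1,\dots,X_n$ be i.i.d. with c.d.f. $F$, well-defined mean $\mu$ and variance $\sigma^2\in(0,+\infty)$. Let $x>0$ and let $k\in\mathbb{N}$ with $k\geq\lceil x^2/2\rceil$. Assume $\xi_*:=(\sqrt2+1)^2\frac kn<1$, and let $v>0$ satisfy \[\frac e6\rho_{F,2}\left(\frac1{36v^2}\frac kn\right)\leq v\quad\text{and}\quad(\sqrt2+1)\rho_{F,2}(\xi_* )\leq v.\] Then \[\Pr\left(|\overline{X}_{n,k}-\mu|>\sigma\,\frac{x+h(\xi_*,v)\sqrt{2k}}{\sqrt n}\right)\leq2\exp\left(-\frac{x^2}2\right)+2\exp(-k),\] where $h(\xi_*,v):=(1-\xi_* )^{-3/2}-1+\frac{\sqrt2\,v}{1-\xi_*}$.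
   Context: $\overline{X}_{n,k}:=\frac1{n-2k}\sum_{i=k+1}^{n-k}X_{(i)}$ with $X_{(1)}\le\dots\le X_{(n)}$ the order statistics. For $\xi>0$, $\rho_{F,2}(\xi):=\sup\{(\mathbb{E}[|X_1-\mu|^2Z])^{1/2}/\sigma: 0\le Z\le1 \text{ a random variable (jointly defined with } X_1), \mathbb{E}Z\le\xi\}$. *)

theory Defs
  imports "HOL-Probability.Probability"
begin

definition trimmed_mean :: "nat \<Rightarrow> real list \<Rightarrow> real" where
  "trimmed_mean k xs =
     sum_list (take (length xs - 2 * k) (drop k (sort xs))) / real (length xs - 2 * k)"

text \<open>rho_{F,2}(xi) for the law D of X_1.  A random variable Z jointly defined with
  X_1 is represented as a measurable function of (X_1, U) with U uniform on [0,1]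
  independent of X_1 (every joint law of (X_1,Z) arises this way).\<close>
definition rho2 :: "real measure \<Rightarrow> real \<Rightarrow> real" where
  "rho2 D \<xi> =
     (let \<mu> = (\<integral>x. x \<partial>D);
          \<sigma> = sqrt (\<integral>x. (x - \<mu>)^2 \<partial>D);
          P = D \<Otimes>\<^sub>M uniform_measure lborel {0..1::real}
      in Sup {sqrt (\<integral>p. (fst p - \<mu>)^2 * Z p \<partial>P) / \<sigma> | Z.
                Z \<in> borel_measurable P \<and> (\<forall>p. 0 \<le> Z p \<and> Z p \<le> 1) \<and>
                (\<integral>p. Z p \<partial>P) \<le> \<xi>})"

definition hfun :: "real \<Rightarrow> real \<Rightarrow> real" where
  "hfun \<xi> v = (1 - \<xi>) powr (-3/2) - 1 + sqrt 2 * v / (1 - \<xi>)"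

end

theory Submission
  imports Defs
begin

text \<open>
  Put \<open>r = sqrt (k / n)\<close>. The bound on \<open>rho2\<close> at \<open>\<xi>s\<close> and Chebyshev's inequality give a truncation
  level \<open>t\<close> of order \<open>\<sigma> v / r\<close> that \<open>\<bar>X - \<mu>\<bar>\<close> exceeds with probability at most \<open>k / (e\<^sup>2 n)\<close>, so by
  Chernoff fewer than \<open>k\<close> observations exceed it, up to probability \<open>exp (- k)\<close>. Then the
  untrimmed observations are not affected by clipping \<open>X - \<mu>\<close> to \<open>[- t, t]\<close>. If some of them lies
  above \<open>\<mu>\<close>, then so do the \<open>k\<close> largest ones, and discarding the extremes increases the clipped sum
  by at most \<open>k t\<close> (the contribution of the \<open>k\<close> smallest); otherwise the trimmed sum is nonpositive.
  Bernstein's inequality for the clipped variables has the sharp main term \<open>x \<sigma> sqrt n\<close>, and the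
  error terms (truncation bias, Bernstein's linear term, and \<open>k t\<close>) add up to at most
  \<open>2 n \<sigma> v r\<close>, because \<open>1 / e + 4 e / 3 \<le> 2 (sqrt 2 + 1)\<close>.
\<close>

section \<open>Exponential inequalities behind Bernstein's bound\<close>

lemma exp_le_quadratic_neg:
  fixes y :: real
  assumes "y \<le> 0"
  shows "exp y \<le> 1 + y + y\<^sup>2 / 2"
proof -
  obtain t where "exp y = (\<Sum>m<3. y ^ m / fact m) + exp t / fact 3 * y ^ 3"
    using Maclaurin_exp_le by blast
  moreover have "exp t / fact 3 * y ^ 3 \<le> 0"
    using assms by (intro mult_nonneg_nonpos) (simp_all add: power_le_zero_eq)
  ultimately show ?thesis
    by (simp add: eval_nat_numeral)
qed

text \<open>Clearing the denominator \<open>3 - y\<close> and multiplying by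
  \<open>exp (- y)\<close> turns the claim into \<open>0 \<le> f y\<close>, where
  \<open>f 0 = 0\<close> and the derivative of \<open>f\<close> is nonnegative by the quadratic
  Taylor bound for \<open>exp\<close>.\<close>

lemma exp_le_quadratic_pos:
  fixes y :: real
  assumes "0 \<le> y" "y < 3"
  shows "exp y \<le> 1 + y + y\<^sup>2 / (2 * (1 - y / 3))"
proof -
  define f where "f z = (3 + 2 * z + z\<^sup>2 / 2) * exp (- z) - (3 - z)" for z :: real
  have "f 0 \<le> f y"
  proof (rule DERIV_nonneg_imp_nondecreasing[OF assms(1)])
    fix z assume z: "0 \<le> z" "z \<le> y"
    have "(f has_real_derivative 1 - (1 + z + z\<^sup>2 / 2) * exp (- z)) (at z)"
      unfolding f_def by (auto intro!: derivative_eq_intros simp: field_simps power2_eq_square)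
    moreover have "(1 + z + z\<^sup>2 / 2) * exp (- z) \<le> exp z * exp (- z)"
      using exp_lower_Taylor_quadratic[OF z(1)] by (intro mult_right_mono) auto
    ultimately show "\<exists>d. (f has_real_derivative d) (at z) \<and> 0 \<le> d"
      by (auto simp flip: exp_add)
  qed
  then have "3 - y \<le> (3 + 2 * y + y\<^sup>2 / 2) * exp (- y)"
    by (simp add: f_def)
  then have "(3 - y) * exp y \<le> 3 + 2 * y + y\<^sup>2 / 2"
    by (simp add: exp_minus field_simps)
  moreover have "1 + y + y\<^sup>2 / (2 * (1 - y / 3)) = (3 + 2 * y + y\<^sup>2 / 2) / (3 - y)"
    using assms by (simp add: field_simps power2_eq_square)
  ultimately show ?thesis
    using assms by (simp add: field_simps)
qed

text \<open>Replacing \<open>y\<close> by its upper bound \<open>b\<close> in the denominator makes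
  the coefficient of \<open>y\<^sup>2\<close> constant, so the expectation of the right side
  involves only the first two moments.\<close>

lemma exp_le_Bernstein:
  fixes y b :: real
  assumes "y \<le> b" "0 \<le> b" "b < 3"
  shows "exp y \<le> 1 + y + y\<^sup>2 / (2 * (1 - b / 3))"
proof (cases "y \<le> 0")
  case True
  have "y\<^sup>2 / 2 \<le> y\<^sup>2 / (2 * (1 - b / 3))"
    using assms by (intro divide_left_mono) auto
  with exp_le_quadratic_neg[OF True] show ?thesis by linarith
next
  case False
  have "y\<^sup>2 / (2 * (1 - y / 3)) \<le> y\<^sup>2 / (2 * (1 - b / 3))"
    using assms by (intro divide_left_mono) auto
  with exp_le_quadratic_pos[of y] False assms show ?thesis by linarith
qed

section \<open>Chernoff and Bernstein tail bounds for independent sums\<close>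

context prob_space
begin

text \<open>Markov's inequality for the exponential of the sum, whose expectation factors by
  independence. The bound \<open>B\<close> stays abstract because it is instantiated twice: for
  bounded variables and for counts of events.\<close>

lemma Chernoff_sum_ge:
  fixes Y :: "'i \<Rightarrow> 'a \<Rightarrow> real"
  assumes fin: "finite I"
    and indep: "indep_vars (\<lambda>_. borel) Y I"
    and int: "\<And>i. i \<in> I \<Longrightarrow> integrable M (\<lambda>\<omega>. exp (l * Y i \<omega>))"
    and mgf: "\<And>i. i \<in> I \<Longrightarrow> expectation (\<lambda>\<omega>. exp (l * Y i \<omega>)) \<le> exp B"
    and "0 < l"
  shows "prob {\<omega> \<in> space M. s \<le> (\<Sum>i\<in>I. Y i \<omega>)} \<le> exp (real (card I) * B - l * s)"
proof -
  have [measurable]: "Y i \<in> borel_measurable M" if "i \<in> I" for i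
    using indep that by (auto simp: indep_vars_def)
  have ind: "indep_vars (\<lambda>_. borel) (\<lambda>i \<omega>. exp (l * Y i \<omega>)) I"
    by (rule indep_vars_compose2[OF indep]) auto
  have prod: "exp (l * (\<Sum>i\<in>I. Y i \<omega>)) = (\<Prod>i\<in>I. exp (l * Y i \<omega>))" for \<omega>
    using fin by (simp add: sum_distrib_left exp_sum)
  have "prob {\<omega> \<in> space M. s \<le> (\<Sum>i\<in>I. Y i \<omega>)}
          \<le> prob {\<omega> \<in> space M. exp (l * s) \<le> (\<Prod>i\<in>I. exp (l * Y i \<omega>))}"
    using \<open>0 < l\<close> by (intro finite_measure_mono) (auto simp flip: prod)
  also have "\<dots> \<le> expectation (\<lambda>\<omega>. \<Prod>i\<in>I. exp (l * Y i \<omega>)) / exp (l * s)"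
    by (intro integral_Markov_inequality_measure[where A = "{}"] indep_vars_integrable[OF fin ind] int)
      (auto intro!: prod_nonneg)
  also have "expectation (\<lambda>\<omega>. \<Prod>i\<in>I. exp (l * Y i \<omega>)) = (\<Prod>i\<in>I. expectation (\<lambda>\<omega>. exp (l * Y i \<omega>)))"
    by (rule indep_vars_lebesgue_integral[OF fin ind int])
  also have "\<dots> \<le> (\<Prod>i\<in>I. exp B)"
    by (intro prod_mono conjI mgf Bochner_Integration.integral_nonneg) auto
  also have "\<dots> = exp (real (card I) * B)"
    by (simp add: exp_of_nat_mult)
  finally show ?thesis
    by (simp add: exp_diff divide_right_mono)
qed

text \<open>Bernstein's inequality solved for the deviation. The variables are not centred: their
  second moment takes the place of the variance, and \<open>t\<close> enters as it is instead of a
  bound on \<open>Y i - m\<close>.\<close>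

lemma Bernstein_sum_ge:
  fixes Y :: "'i \<Rightarrow> 'a \<Rightarrow> real"
  assumes fin: "finite I" and ne: "I \<noteq> {}"
    and indep: "indep_vars (\<lambda>_. borel) Y I"
    and bound: "\<And>i \<omega>. i \<in> I \<Longrightarrow> \<bar>Y i \<omega>\<bar> \<le> t"
    and mean: "\<And>i. i \<in> I \<Longrightarrow> expectation (Y i) = m"
    and second: "\<And>i. i \<in> I \<Longrightarrow> expectation (\<lambda>\<omega>. (Y i \<omega>)\<^sup>2) \<le> s\<^sup>2"
    and pos: "0 < t" "0 < s" "0 < x"
  shows "prob {\<omega> \<in> space M. real (card I) * m + x * s * sqrt (card I) + t * x\<^sup>2 / 6 \<le> (\<Sum>i\<in>I. Y i \<omega>)}
           \<le> exp (- (x\<^sup>2 / 2))"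
proof -
  define n where "n = real (card I)"
  define c where "c = t / 3"
  define u where "u = x / (s * sqrt n)"
  \<comment> \<open>Optimal for a sub-gamma variable with variance factor \<open>n s\<^sup>2\<close> and scale \<open>c\<close>.\<close>
  define l where "l = u / (1 + c * u)"
  have n: "0 < n" unfolding n_def using fin ne by (simp add: card_gt_0_iff)
  have u: "0 < u" and c: "0 < c" using n pos by (simp_all add: u_def c_def)
  have cu: "0 < 1 + c * u" using u c by (simp add: add_pos_pos)
  have l: "0 < l" using u cu by (simp add: l_def)
  \<comment> \<open>Since \<open>c = t / 3\<close>, the denominator of the quadratic exponential
    bound becomes explicit, and its positivity yields \<open>l * t < 3\<close>.\<close>
  have lc: "1 - l * t / 3 = 1 / (1 + c * u)"
    using cu by (simp add: l_def c_def field_simps)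
  have lt3: "l * t < 3"
  proof -
    have "0 < 1 / (1 + c * u)" using cu by simp
    with lc show ?thesis by linarith
  qed
  have xu: "x = u * s * sqrt n" using n pos by (simp add: u_def)
  have xs: "x\<^sup>2 = u\<^sup>2 * s\<^sup>2 * n" using n by (simp add: xu power_mult_distrib)
  define B where "B = l * m + l\<^sup>2 * s\<^sup>2 / (2 * (1 - l * t / 3))"
  have meas: "Y i \<in> borel_measurable M" if "i \<in> I" for i
    using indep that by (auto simp: indep_vars_def)
  have int_exp: "integrable M (\<lambda>\<omega>. exp (l * Y i \<omega>))" if "i \<in> I" for i
  proof (rule integrable_const_bound[where B = "exp (l * t)"])
    show "AE \<omega> in M. norm (exp (l * Y i \<omega>)) \<le> exp (l * t)"
      using bound[OF that] l by (auto simp: abs_le_iff)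
  qed (use meas[OF that] in measurable)
  have mgf: "expectation (\<lambda>\<omega>. exp (l * Y i \<omega>)) \<le> exp B" if i: "i \<in> I" for i
  proof -
    have int1: "integrable M (Y i)"
      using bound[OF i] by (intro integrable_const_bound[where B = t] meas i) auto
    have int2: "integrable M (\<lambda>\<omega>. (Y i \<omega>)\<^sup>2)"
    proof (rule integrable_const_bound[where B = "t\<^sup>2"])
      show "AE \<omega> in M. norm ((Y i \<omega>)\<^sup>2) \<le> t\<^sup>2"
        using bound[OF i] pos by (auto simp: abs_le_square_iff[symmetric])
    qed (use meas[OF i] in measurable)
    have "expectation (\<lambda>\<omega>. exp (l * Y i \<omega>))
        \<le> expectation (\<lambda>\<omega>. 1 + l * Y i \<omega> + l\<^sup>2 * (Y i \<omega>)\<^sup>2 / (2 * (1 - l * t / 3)))"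
    proof (intro integral_mono int_exp i)
      show "integrable M (\<lambda>\<omega>. 1 + l * Y i \<omega> + l\<^sup>2 * (Y i \<omega>)\<^sup>2 / (2 * (1 - l * t / 3)))"
        using int1 int2 by auto
      fix \<omega>
      have "l * Y i \<omega> \<le> l * t" using bound[OF i, of \<omega>] l by (simp add: abs_le_iff)
      from exp_le_Bernstein[OF this] lt3 l pos
      show "exp (l * Y i \<omega>) \<le> 1 + l * Y i \<omega> + l\<^sup>2 * (Y i \<omega>)\<^sup>2 / (2 * (1 - l * t / 3))"
        by (simp add: power_mult_distrib)
    qed
    also have "\<dots> = 1 + l * m + l\<^sup>2 * expectation (\<lambda>\<omega>. (Y i \<omega>)\<^sup>2) / (2 * (1 - l * t / 3))"
      using int1 int2 mean[OF i] by (simp add: prob_space)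
    also have "\<dots> \<le> 1 + B"
      using second[OF i] lt3 unfolding B_def
      by (auto intro!: divide_right_mono mult_left_mono)
    also have "\<dots> \<le> exp B" by (rule exp_ge_add_one_self)
    finally show ?thesis .
  qed
  \<comment> \<open>At this threshold the exponent can be computed exactly: the mean cancels, and
    \<open>l * (1 + c * u) = u\<close> collapses the rest into a multiple of
    \<open>u\<^sup>2 * s\<^sup>2 * n\<close>, which is \<open>x\<^sup>2\<close>.\<close>
  define a where "a = n * m + x * s * sqrt n + t * x\<^sup>2 / 6"
  have "n * B - l * a = n * l\<^sup>2 * s\<^sup>2 * (1 + c * u) / 2 - l * (x * s * sqrt n) - l * t * x\<^sup>2 / 6"
    unfolding B_def a_def lc by (simp add: algebra_simps)
  also have "\<dots> = n * l * u * s\<^sup>2 / 2 - l * (u * s\<^sup>2 * n) - l * c * (u\<^sup>2 * s\<^sup>2 * n) / 2"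
  proof -
    have "l * (1 + c * u) = u" using cu by (simp add: l_def)
    then have "n * l\<^sup>2 * s\<^sup>2 * (1 + c * u) = n * l * u * s\<^sup>2"
      by (simp add: power2_eq_square mult.assoc mult.left_commute)
    moreover have "x * s * sqrt n = u * s\<^sup>2 * n"
      using n by (simp add: xu power2_eq_square)
    ultimately have "n * l\<^sup>2 * s\<^sup>2 * (1 + c * u) / 2 - l * (x * s * sqrt n) - l * t * x\<^sup>2 / 6
        = n * l * u * s\<^sup>2 / 2 - l * (u * s\<^sup>2 * n) - l * t * x\<^sup>2 / 6"
      by (simp only:)
    then show ?thesis by (simp add: xs c_def)
  qed
  also have "\<dots> = - (l * (1 + c * u)) * u * s\<^sup>2 * n / 2"
    by (simp add: algebra_simps power2_eq_square)
  also have "\<dots> = - (x\<^sup>2 / 2)"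
    using cu unfolding xs by (simp add: l_def power2_eq_square)
  finally have eq: "n * B - l * a = - (x\<^sup>2 / 2)" .
  show ?thesis
    using Chernoff_sum_ge[OF fin indep int_exp mgf l, of a]
    unfolding n_def[symmetric] eq by (simp add: a_def)
qed

text \<open>Chernoff with parameter 2, matched to the factor \<open>exp (- 2)\<close> in the
  hypothesis: the log-moments add up to at most \<open>(1 - exp (- 2)) * k\<close>, so subtracting
  \<open>2 * k\<close> leaves at most \<open>- k\<close>.\<close>

lemma prob_many_events_le:
  assumes fin: "finite I"
    and indep: "indep_vars (\<lambda>_. borel) X I"
    and A: "A \<in> sets borel"
    and p: "\<And>i. i \<in> I \<Longrightarrow> prob {\<omega> \<in> space M. X i \<omega> \<in> A} \<le> p"
    and small: "real (card I) * p \<le> exp (- 2) * real k"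
  shows "prob {\<omega> \<in> space M. real k \<le> (\<Sum>i\<in>I. indicator A (X i \<omega>))} \<le> exp (- real k)"
proof -
  note A[measurable]
  have [measurable]: "X i \<in> borel_measurable M" if "i \<in> I" for i
    using indep that by (auto simp: indep_vars_def)
  define Y :: "'b \<Rightarrow> 'a \<Rightarrow> real" where "Y i \<omega> = indicator A (X i \<omega>)" for i \<omega>
  have ind: "indep_vars (\<lambda>_. borel) Y I"
    unfolding Y_def by (rule indep_vars_compose2[OF indep]) auto
  have eq: "exp (2 * Y i \<omega>) = 1 + (exp 2 - 1) * indicator {\<omega> \<in> space M. X i \<omega> \<in> A} \<omega>"
    if "\<omega> \<in> space M" for i \<omega>
    using that by (simp add: Y_def indicator_def)
  have int: "integrable M (\<lambda>\<omega>. exp (2 * Y i \<omega>))" if "i \<in> I" for i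
    using that by (intro integrable_const_bound[where B = "exp 2"]) (auto simp: Y_def indicator_def)
  have "expectation (\<lambda>\<omega>. exp (2 * Y i \<omega>)) \<le> exp ((exp 2 - 1) * p)" if i: "i \<in> I" for i
  proof -
    have "expectation (\<lambda>\<omega>. exp (2 * Y i \<omega>)) = 1 + (exp 2 - 1) * prob {\<omega> \<in> space M. X i \<omega> \<in> A}"
    proof -
      define E where "E = {\<omega> \<in> space M. X i \<omega> \<in> A}"
      have E: "E \<in> events" unfolding E_def using i by measurable
      then have "integrable M (indicator E :: 'a \<Rightarrow> real)"
        by (simp add: integrable_real_indicator emeasure_eq_measure)
      with E show ?thesis
        unfolding E_def[symmetric]
        by (subst Bochner_Integration.integral_cong[OF refl eq[folded E_def]])
          (simp_all add: prob_space E_def)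
    qed
    also have "\<dots> \<le> 1 + (exp 2 - 1) * p"
      using p[OF i] by (intro add_left_mono mult_left_mono) auto
    also have "\<dots> \<le> exp ((exp 2 - 1) * p)" by (rule exp_ge_add_one_self)
    finally show ?thesis .
  qed
  from Chernoff_sum_ge[OF fin ind int this, of "real k"]
  have "prob {\<omega> \<in> space M. real k \<le> (\<Sum>i\<in>I. Y i \<omega>)}
      \<le> exp (real (card I) * ((exp 2 - 1) * p) - 2 * real k)" by simp
  also have "\<dots> \<le> exp (- real k)"
  proof -
    have "(exp 2 - 1) * (real (card I) * p) \<le> (exp 2 - 1) * (exp (- 2) * real k)"
      using small by (intro mult_left_mono) auto
    also have "\<dots> = (1 - exp (- 2)) * real k"
      by (simp add: algebra_simps exp_minus)
    also have "\<dots> \<le> 1 * real k"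
      by (intro mult_right_mono) auto
    finally show ?thesis by (simp add: mult.left_commute)
  qed
  finally show ?thesis by (simp add: Y_def)
qed

end

section \<open>Competitors in the supremum \<open>rho2\<close>\<close>

text \<open>A weight depending on the observation alone competes in the supremum after composition
  with \<open>fst\<close>, because the first marginal of the product measure is
  \<open>D\<close>.\<close>

lemma rho2_bound:
  assumes D: "prob_space D" "sets D = sets borel"
    and \<mu>: "\<mu> = (\<integral>y. y \<partial>D)"
    and \<sigma>: "\<sigma> = sqrt (\<integral>y. (y - \<mu>)\<^sup>2 \<partial>D)" "0 < \<sigma>"
    and int: "integrable D (\<lambda>y. (y - \<mu>)\<^sup>2)"
    and Z: "Z \<in> borel_measurable borel" "\<And>y. 0 \<le> Z y" "\<And>y. Z y \<le> 1"
    and mass: "(\<integral>y. Z y \<partial>D) \<le> \<xi>"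
  shows "sqrt (\<integral>y. (y - \<mu>)\<^sup>2 * Z y \<partial>D) \<le> \<sigma> * rho2 D \<xi>"
proof -
  interpret D: prob_space D by fact
  define U where "U = uniform_measure lborel {0..1::real}"
  interpret U: prob_space U
    unfolding U_def by (rule prob_space_uniform_measure) auto
  define P where "P = D \<Otimes>\<^sub>M U"
  have D_eq: "distr P D fst = D"
    unfolding P_def by (rule U.distr_pair_fst)
  have fst_P [measurable]: "fst \<in> measurable P D"
    unfolding P_def by simp
  have meas_D: "f \<in> borel_measurable D" if "f \<in> borel_measurable borel" for f :: "real \<Rightarrow> real"
    using that by (simp add: measurable_cong_sets[OF D(2) refl])
  have fst_int: "(\<integral>p. f (fst p) \<partial>P) = (\<integral>y. f y \<partial>D)"
    if "f \<in> borel_measurable borel" for f :: "real \<Rightarrow> real"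
    using integral_distr[OF fst_P meas_D[OF that]] D_eq by simp
  have sq_P: "integrable P (\<lambda>p. (fst p - \<mu>)\<^sup>2)"
    using integrable_distr_eq[OF fst_P meas_D, of "\<lambda>y. (y - \<mu>)\<^sup>2"] D_eq int by simp
  define S where "S = {sqrt (\<integral>p. (fst p - \<mu>)\<^sup>2 * Z p \<partial>P) / \<sigma> | Z.
      Z \<in> borel_measurable P \<and> (\<forall>p. 0 \<le> Z p \<and> Z p \<le> 1) \<and> (\<integral>p. Z p \<partial>P) \<le> \<xi>}"
  have rho: "rho2 D \<xi> = Sup S"
    unfolding rho2_def Let_def S_def P_def U_def \<sigma>(1) \<mu> ..
  \<comment> \<open>A real \<open>Sup\<close> dominates the members of its set only once the set is
    known to be bounded above; normalising by \<open>\<sigma>\<close> gives the bound 1.\<close>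
  have "bdd_above S"
  proof (rule bdd_aboveI)
    fix s assume "s \<in> S"
    then obtain Z' where s: "s = sqrt (\<integral>p. (fst p - \<mu>)\<^sup>2 * Z' p \<partial>P) / \<sigma>"
      and Z': "Z' \<in> borel_measurable P" "\<And>p. 0 \<le> Z' p" "\<And>p. Z' p \<le> 1"
      unfolding S_def by auto
    have "(\<integral>p. (fst p - \<mu>)\<^sup>2 * Z' p \<partial>P) \<le> (\<integral>p. (fst p - \<mu>)\<^sup>2 \<partial>P)"
      using Z' by (intro integral_mono' sq_P) (auto intro: mult_left_le)
    also have "\<dots> = (\<integral>y. (y - \<mu>)\<^sup>2 \<partial>D)"
      by (rule fst_int) simp
    finally show "s \<le> 1"
      unfolding s using \<sigma> by simp
  qed
  moreover have "sqrt (\<integral>y. (y - \<mu>)\<^sup>2 * Z y \<partial>D) / \<sigma> \<in> S"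
  proof -
    have "(\<lambda>p. Z (fst p)) \<in> borel_measurable P"
      using measurable_compose[OF fst_P meas_D[OF Z(1)]] .
    moreover have "(\<integral>p. Z (fst p) \<partial>P) \<le> \<xi>"
      using mass fst_int[OF Z(1)] by simp
    moreover have "(\<integral>p. (fst p - \<mu>)\<^sup>2 * Z (fst p) \<partial>P) = (\<integral>y. (y - \<mu>)\<^sup>2 * Z y \<partial>D)"
      by (rule fst_int) (use Z(1) in measurable)
    ultimately show ?thesis
      unfolding S_def using Z by (intro CollectI exI[of _ "\<lambda>p. Z (fst p)"]) auto
  qed
  ultimately have "sqrt (\<integral>y. (y - \<mu>)\<^sup>2 * Z y \<partial>D) / \<sigma> \<le> rho2 D \<xi>"
    unfolding rho by (rule cSup_upper[rotated])
  then show ?thesis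
    using \<sigma>(2) by (simp add: field_simps)
qed

section \<open>Clipping and the deterministic effect of trimming\<close>

definition clip :: "real \<Rightarrow> real \<Rightarrow> real" where
  "clip t y = max (- t) (min t y)"

lemma abs_clip_le: "0 \<le> t \<Longrightarrow> \<bar>clip t y\<bar> \<le> t"
  by (auto simp: clip_def)

lemma clip_eq: "\<bar>y\<bar> \<le> t \<Longrightarrow> clip t y = y"
  by (auto simp: clip_def)

lemma measurable_clip [measurable]: "clip t \<in> borel_measurable borel"
  unfolding clip_def by measurable

text \<open>The clipped total splits over the \<open>k\<close> smallest, the retained and the
  \<open>k\<close> largest values. A sign argument makes one discarded block harmless, so the cost
  is \<open>k * t\<close> rather than \<open>2 * k * t\<close>.\<close>

lemma trimmed_sum_deviation:
  fixes xs :: "real list"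
  assumes k: "2 * k \<le> length xs" and "0 \<le> t"
    and few: "length (filter (\<lambda>y. t < \<bar>y - \<mu>\<bar>) xs) < k"
  shows "\<bar>sum_list (take (length xs - 2 * k) (drop k (sort xs))) - real (length xs - 2 * k) * \<mu>\<bar>
    \<le> \<bar>\<Sum>y\<leftarrow>xs. clip t (y - \<mu>)\<bar> + real k * t"
proof -
  define A B C where "A = take k (sort xs)"
    and "B = take (length xs - 2 * k) (drop k (sort xs))"
    and "C = drop (length xs - 2 * k) (drop k (sort xs))"
  have split: "sort xs = A @ B @ C"
    unfolding A_def B_def C_def by (metis append_take_drop_id)
  have len: "length A = k" "length B = length xs - 2 * k" "length C = k"
    using k by (auto simp: A_def B_def C_def)
  have "sorted (A @ B @ C)"
    by (simp flip: split)
  then have AB: "\<And>a b. a \<in> set A \<Longrightarrow> b \<in> set B \<Longrightarrow> a \<le> b"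
    and BC: "\<And>b c. b \<in> set B \<Longrightarrow> c \<in> set C \<Longrightarrow> b \<le> c"
    by (auto simp: sorted_append)
  have few': "length (filter (\<lambda>y. t < \<bar>y - \<mu>\<bar>) (A @ B @ C)) < k"
    using few by (simp flip: split add: filter_sort)
  \<comment> \<open>A retained outlier on the right would make all \<open>k\<close> entries of
    \<open>C\<close> outliers, and one on the left all \<open>k\<close> entries of
    \<open>A\<close>.\<close>
  have B_le: "\<bar>b - \<mu>\<bar> \<le> t" if b: "b \<in> set B" for b
  proof (rule ccontr)
    assume "\<not> \<bar>b - \<mu>\<bar> \<le> t"
    then consider "t < b - \<mu>" | "b - \<mu> < - t" by linarith
    then show False
    proof cases
      case 1
      then have "filter (\<lambda>y. t < \<bar>y - \<mu>\<bar>) C = C"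
        using BC[OF b] by (force intro: filter_True)
      then show False using few' len by simp
    next
      case 2
      then have "filter (\<lambda>y. t < \<bar>y - \<mu>\<bar>) A = A"
        using AB[OF _ b] by (force intro: filter_True)
      then show False using few' len by simp
    qed
  qed
  define g where "g y = clip t (y - \<mu>)" for y
  have sum_g: "(\<Sum>y\<leftarrow>xs. g y) = sum_list (map g A) + sum_list (map g B) + sum_list (map g C)"
  proof -
    have "(\<Sum>y\<leftarrow>xs. g y) = (\<Sum>y\<leftarrow>sort xs. g y)"
      by (metis mset_map mset_sort sum_mset_sum_list)
    then show ?thesis by (simp add: split)
  qed
  have gB: "sum_list (map g B) = sum_list B - real (length xs - 2 * k) * \<mu>"
  proof -
    have "map g B = map (\<lambda>y. y - \<mu>) B"
      using B_le by (auto simp: g_def clip_eq)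
    then show ?thesis
      by (simp only: sum_list_subtractf) (simp add: sum_list_triv len)
  qed
  have g_bounds: "- t \<le> g y" "g y \<le> t" for y
    using abs_clip_le[OF \<open>0 \<le> t\<close>, of "y - \<mu>"] unfolding g_def by linarith+
  have low: "- (real (length L) * t) \<le> sum_list (map g L)" for L
    using sum_list_mono[of L "\<lambda>_. - t" g] g_bounds by (simp add: sum_list_triv)
  have up: "sum_list (map g L) \<le> real (length L) * t" for L
    using sum_list_mono[of L g "\<lambda>_. t"] g_bounds by (simp add: sum_list_triv)
  have g_pos: "0 \<le> g y" if "\<mu> \<le> y" for y
    using that \<open>0 \<le> t\<close> by (simp add: g_def clip_def)
  have g_neg: "g y \<le> 0" if "y \<le> \<mu>" for y
    using that \<open>0 \<le> t\<close> by (simp add: g_def clip_def)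
  \<comment> \<open>If some retained value is at least \<open>\<mu>\<close>, then \<open>C\<close>
    contributes nonnegatively and only \<open>A\<close> has to be paid for. The lower bound below is
    the mirror image.\<close>
  have "sum_list (map g B) \<le> \<bar>\<Sum>y\<leftarrow>xs. g y\<bar> + real k * t"
  proof (cases "\<exists>b\<in>set B. \<mu> \<le> b")
    case True
    then have "\<mu> \<le> c" if "c \<in> set C" for c
      using BC that by force
    then have "0 \<le> sum_list (map g C)"
      using g_pos by (intro sum_list_nonneg) auto
    with low[of A] sum_g len show ?thesis by simp
  next
    case False
    then have "sum_list (map g B) \<le> 0"
      using g_neg by (intro sum_list_nonpos) force
    moreover have "0 \<le> real k * t" using \<open>0 \<le> t\<close> by simp
    ultimately show ?thesis by linarith
  qed
  moreover have "- sum_list (map g B) \<le> \<bar>\<Sum>y\<leftarrow>xs. g y\<bar> + real k * t"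
  proof (cases "\<exists>b\<in>set B. b \<le> \<mu>")
    case True
    then have "a \<le> \<mu>" if "a \<in> set A" for a
      using AB that by force
    then have "sum_list (map g A) \<le> 0"
      using g_neg by (intro sum_list_nonpos) auto
    with up[of C] sum_g len show ?thesis by simp
  next
    case False
    then have "0 \<le> sum_list (map g B)"
      using g_pos by (intro sum_list_nonneg) force
    moreover have "0 \<le> real k * t" using \<open>0 \<le> t\<close> by simp
    ultimately show ?thesis by linarith
  qed
  ultimately show ?thesis
    unfolding gB by (simp add: B_def g_def abs_le_iff)
qed

section \<open>Arithmetic from the trimmed sum to the trimmed mean\<close>

text \<open>Dividing by \<open>N\<close> inflates \<open>x\<close> by the factor
  \<open>a = 1 / (1 - \<xi>)\<close>. The excess \<open>(a - 1) * x\<close> is absorbed by the first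
  part of \<open>hfun\<close>, using \<open>x \<le> sqrt (2 * k)\<close> and
  \<open>a \<le> b\<close>; the \<open>v\<close> term becomes the second part.\<close>

lemma deviation_budget:
  fixes n N k x \<sigma> v \<xi> S :: real
  assumes \<xi>: "0 \<le> \<xi>" "\<xi> < 1" and N: "n * (1 - \<xi>) \<le> N" and "0 < n" "0 \<le> k" "0 \<le> \<sigma>" "0 \<le> v"
    and x: "0 \<le> x" "x \<le> sqrt (2 * k)"
    and S: "S \<le> x * \<sigma> * sqrt n + 2 * n * \<sigma> * v * sqrt (k / n)"
  shows "S / N \<le> \<sigma> * (x + hfun \<xi> v * sqrt (2 * k)) / sqrt n"
proof -
  define a b where "a = 1 / (1 - \<xi>)" and "b = (1 - \<xi>) powr (- 3 / 2)"
  define S' where "S' = x * \<sigma> * sqrt n + 2 * n * \<sigma> * v * sqrt (k / n)"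
  have nN: "0 < n * (1 - \<xi>)" using assms by simp
  have "1 \<le> a" using \<xi> by (simp add: a_def)
  have "a \<le> b"
  proof -
    have "(1 - \<xi>) powr (- 1) \<le> (1 - \<xi>) powr (- 3 / 2)"
      using \<xi> by (intro powr_mono') auto
    then show ?thesis
      using \<xi> by (simp add: a_def b_def powr_minus_divide)
  qed
  have "(a - 1) * x \<le> (b - 1) * sqrt (2 * k)"
    using \<open>1 \<le> a\<close> \<open>a \<le> b\<close> x by (intro mult_mono) auto
  then have ax: "a * x \<le> x + (b - 1) * sqrt (2 * k)"
    by (simp add: algebra_simps)
  \<comment> \<open>\<open>S\<close> may be negative; passing first to the nonnegative
    \<open>S'\<close> permits shrinking the denominator.\<close>
  have "S / N \<le> S' / N"
    using S nN N unfolding S'_def by (intro divide_right_mono) auto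
  also have "\<dots> \<le> S' / (n * (1 - \<xi>))"
    using assms nN less_le_trans[OF nN N] unfolding S'_def by (intro divide_left_mono mult_pos_pos) auto
  also have "\<dots> = \<sigma> * (a * x + 2 * v * a * sqrt k) / sqrt n"
  proof -
    define z d where "z = sqrt n" and "d = 1 - \<xi>"
    have z: "0 < z" "n = z * z" and d: "0 < d"
      using \<open>0 < n\<close> \<xi> by (simp_all add: z_def d_def)
    show ?thesis
      using z(1) d unfolding S'_def a_def real_sqrt_divide z_def[symmetric] d_def[symmetric] z(2)
      by (simp add: field_simps)
  qed
  also have "\<dots> \<le> \<sigma> * (x + (b - 1) * sqrt (2 * k) + 2 * v * a * sqrt k) / sqrt n"
    using ax assms by (intro divide_right_mono mult_left_mono) auto
  also have "x + (b - 1) * sqrt (2 * k) + 2 * v * a * sqrt k = x + hfun \<xi> v * sqrt (2 * k)"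
    by (simp add: hfun_def b_def a_def real_sqrt_mult algebra_simps add_divide_distrib)
  finally show ?thesis .
qed


section \<open>Tail moments and the bias of clipping\<close>

text \<open>The condition \<open>W\<^sup>2 < t\<^sup>2 * \<xi>\<close> forces the tail event to have
  mass at most \<open>\<xi>\<close>, so that its indicator is an admissible weight for
  \<open>rho2\<close>. The second bound is Chebyshev's inequality applied to the second moment on
  the tail only.\<close>

lemma tail_bounds:
  assumes D: "prob_space D" "sets D = sets borel"
    and \<mu>: "\<mu> = (\<integral>y. y \<partial>D)"
    and \<sigma>: "\<sigma> = sqrt (\<integral>y. (y - \<mu>)\<^sup>2 \<partial>D)" "0 < \<sigma>"
    and int: "integrable D (\<lambda>y. (y - \<mu>)\<^sup>2)"
    and \<xi>: "0 < \<xi>" and W: "\<sigma> * rho2 D \<xi> \<le> W" and t: "0 < t" "W\<^sup>2 < t\<^sup>2 * \<xi>"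
  shows "(\<integral>y. (y - \<mu>)\<^sup>2 * indicator {y. t < \<bar>y - \<mu>\<bar>} y \<partial>D) \<le> W\<^sup>2"
    and "t\<^sup>2 * measure D {y. t < \<bar>y - \<mu>\<bar>} \<le> W\<^sup>2"
proof -
  interpret D: prob_space D by fact
  have sp: "space D = UNIV"
    using sets_eq_imp_space_eq[OF D(2)] by simp
  define E where "E = {y. t < \<bar>y - \<mu>\<bar>}"
  have E[measurable]: "E \<in> sets borel"
    unfolding E_def by measurable
  have E_D: "E \<in> sets D" using D(2) E by simp
  define q where "q = measure D E"
  have int_ind: "(\<integral>y. c * indicator E y \<partial>D) = c * q" for c :: real
    using E_D by (simp add: q_def sp)
  have int_E: "integrable D (\<lambda>y. c * indicator E y)" for c :: real
    using E_D by (intro integrable_mult_right integrable_real_indicator) (auto simp: D.emeasure_eq_measure)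
  have int_sq: "integrable D (\<lambda>y. (y - \<mu>)\<^sup>2 * (c * indicator E y))" for c :: real
    using integrable_mult_right[OF integrable_real_mult_indicator[OF E_D int], of c]
    by (simp add: mult_ac)
  \<comment> \<open>Scaling the indicator by \<open>c = \<xi> / q\<close> rules out \<open>q > \<xi>\<close>; then \<open>c = 1\<close> is admissible.\<close>
  have main: "(\<integral>y. (y - \<mu>)\<^sup>2 * (c * indicator E y) \<partial>D) \<le> W\<^sup>2"
    if "0 \<le> c" "c \<le> 1" "c * q \<le> \<xi>" for c
  proof -
    have "sqrt (\<integral>y. (y - \<mu>)\<^sup>2 * (c * indicator E y) \<partial>D) \<le> \<sigma> * rho2 D \<xi>"
    proof (rule rho2_bound[OF D \<mu> \<sigma> int])
      show "(\<integral>y. c * indicator E y \<partial>D) \<le> \<xi>"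
        using that by (simp only: int_ind)
    qed (use that in \<open>auto simp: indicator_def\<close>)
    then show ?thesis
      using W sqrt_le_D order_trans by blast
  qed
  have low: "t\<^sup>2 * (c * q) \<le> (\<integral>y. (y - \<mu>)\<^sup>2 * (c * indicator E y) \<partial>D)" if "0 \<le> c" for c
  proof -
    have "t\<^sup>2 * (c * q) = (\<integral>y. (t\<^sup>2 * c) * indicator E y \<partial>D)"
      by (simp only: int_ind mult.assoc[of "t\<^sup>2" c q])
    also have "\<dots> \<le> (\<integral>y. (y - \<mu>)\<^sup>2 * (c * indicator E y) \<partial>D)"
    proof (intro integral_mono int_E int_sq)
      fix y
      have "t\<^sup>2 \<le> (y - \<mu>)\<^sup>2" if "y \<in> E"
        using that t(1) by (simp add: E_def flip: abs_le_square_iff)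
      then show "t\<^sup>2 * c * indicator E y \<le> (y - \<mu>)\<^sup>2 * (c * indicator E y)"
        using \<open>0 \<le> c\<close> by (auto simp: indicator_def intro!: mult_right_mono)
    qed
    finally show ?thesis .
  qed
  have "q \<le> \<xi>"
  proof (rule ccontr)
    assume q: "\<not> q \<le> \<xi>"
    then have "t\<^sup>2 * \<xi> \<le> W\<^sup>2"
      using low[of "\<xi> / q"] main[of "\<xi> / q"] \<xi> by simp
    with t(2) show False by simp
  qed
  then show "(\<integral>y. (y - \<mu>)\<^sup>2 * indicator {y. t < \<bar>y - \<mu>\<bar>} y \<partial>D) \<le> W\<^sup>2"
    and "t\<^sup>2 * measure D {y. t < \<bar>y - \<mu>\<bar>} \<le> W\<^sup>2"
    using main[of 1] low[of 1] by (auto simp: E_def q_def)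
qed

text \<open>As \<open>y - \<mu>\<close> integrates to 0, the clipped mean is the mean of the
  clipping error. This error vanishes off the tail, where it is at most
  \<open>\<bar>y - \<mu>\<bar>\<close>, hence at most
  \<open>(y - \<mu>)\<^sup>2 / t\<close>.\<close>

lemma clip_mean_bound:
  assumes D: "prob_space D" "sets D = sets borel"
    and \<mu>: "\<mu> = (\<integral>y. y \<partial>D)"
    and int1: "integrable D (\<lambda>y. y)" and int2: "integrable D (\<lambda>y. (y - \<mu>)\<^sup>2)"
    and t: "0 < t"
  shows "\<bar>\<integral>y. clip t (y - \<mu>) \<partial>D\<bar> \<le> (\<integral>y. (y - \<mu>)\<^sup>2 * indicator {y. t < \<bar>y - \<mu>\<bar>} y \<partial>D) / t"
proof -
  interpret D: prob_space D by fact
  have meas_D: "f \<in> borel_measurable D" if "f \<in> borel_measurable borel" for f :: "real \<Rightarrow> real"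
    using that by (simp add: measurable_cong_sets[OF D(2) refl])
  have int_clip: "integrable D (\<lambda>y. clip t (y - \<mu>))"
  proof (rule D.integrable_const_bound[where B = t])
    show "AE y in D. norm (clip t (y - \<mu>)) \<le> t"
      using t by (simp add: abs_clip_le)
    show "(\<lambda>y. clip t (y - \<mu>)) \<in> borel_measurable D"
      by (rule meas_D) measurable
  qed
  have "{y. t < \<bar>y - \<mu>\<bar>} \<in> sets D"
    unfolding D(2) by measurable
  from integrable_real_mult_indicator[OF this int2]
  have int_sq: "integrable D (\<lambda>y. (y - \<mu>)\<^sup>2 * indicator {y. t < \<bar>y - \<mu>\<bar>} y / t)"
    by (simp add: mult.commute)
  have int_diff: "integrable D (\<lambda>y. clip t (y - \<mu>) - (y - \<mu>))"
    using int_clip int1 by simp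
  have "(\<integral>y. clip t (y - \<mu>) \<partial>D) = (\<integral>y. clip t (y - \<mu>) - (y - \<mu>) \<partial>D)"
    using int_clip int1 by (simp add: D.prob_space \<mu>)
  also have "\<bar>\<dots>\<bar> \<le> (\<integral>y. \<bar>clip t (y - \<mu>) - (y - \<mu>)\<bar> \<partial>D)"
    by (rule integral_abs_bound)
  also have "\<dots> \<le> (\<integral>y. (y - \<mu>)\<^sup>2 * indicator {y. t < \<bar>y - \<mu>\<bar>} y / t \<partial>D)"
  proof (intro integral_mono integrable_abs int_diff int_sq)
    fix y
    show "\<bar>clip t (y - \<mu>) - (y - \<mu>)\<bar> \<le> (y - \<mu>)\<^sup>2 * indicator {y. t < \<bar>y - \<mu>\<bar>} y / t"
    proof (cases "t < \<bar>y - \<mu>\<bar>")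
      case True
      have "\<bar>clip t (y - \<mu>) - (y - \<mu>)\<bar> \<le> \<bar>y - \<mu>\<bar>"
        using t by (auto simp: clip_def)
      moreover have "\<bar>y - \<mu>\<bar> * t \<le> \<bar>y - \<mu>\<bar> * \<bar>y - \<mu>\<bar>"
        using True by (intro mult_left_mono) auto
      then have "\<bar>y - \<mu>\<bar> \<le> (y - \<mu>)\<^sup>2 / t"
        using t by (simp add: field_simps power2_eq_square)
      ultimately show ?thesis using True by simp
    qed (simp add: clip_eq)
  qed
  finally show ?thesis by simp
qed

text \<open>Collects the error terms of the final estimate: \<open>1 / exp 1\<close> from the bias,
  \<open>exp 1\<close> from the discarded values, and a third of that from Bernstein's linear term.
  The crude bounds on \<open>exp 1\<close> and \<open>sqrt 2\<close> meet at 9/2.\<close>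

lemma exp_constant_bound: "1 / exp 1 + 4 / 3 * exp 1 \<le> 2 * (sqrt 2 + 1 :: real)"
proof -
  have e: "exp 1 \<le> (3::real)" "2 \<le> (exp 1 :: real)"
    using exp_le exp_ge_add_one_self[of 1] by simp_all
  have "1 / exp 1 \<le> (1 / 2 :: real)"
    using e by (intro divide_left_mono) auto
  moreover have "4 / 3 * exp 1 \<le> (4 :: real)"
    using e by simp
  ultimately have "1 / exp 1 + 4 / 3 * exp 1 \<le> (1 / 2 + 4 :: real)"
    by (rule add_mono)
  also have "1 / 2 + 4 \<le> 2 * (sqrt 2 + 1 :: real)"
  proof -
    have "(5 / 4 :: real) \<le> sqrt 2"
      by (rule real_le_rsqrt) (simp add: power2_eq_square)
    then show ?thesis by simp
  qed
  finally show ?thesis .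
qed

section \<open>Concentration of the trimmed mean\<close>

theorem theorem5p1:
  fixes M :: "'a measure" and X :: "nat \<Rightarrow> 'a \<Rightarrow> real"
    and n k :: nat and x v \<mu> \<sigma> \<xi>s :: real
  assumes "prob_space M"
    and rv: "\<And>i. i \<in> {1..n} \<Longrightarrow> X i \<in> borel_measurable M"
    and indep: "prob_space.indep_vars M (\<lambda>_. borel) X {1..n}"
    and ident: "\<And>i. i \<in> {1..n} \<Longrightarrow> distr M borel (X i) = distr M borel (X 1)"
    and n_pos: "n \<ge> 1"
    and int1: "integrable M (X 1)"
    and int2: "integrable M (\<lambda>\<omega>. (X 1 \<omega>)^2)"
    and mu: "\<mu> = prob_space.expectation M (X 1)"
    and sigma: "\<sigma> = sqrt (prob_space.variance M (X 1))"
    and sigma_pos: "\<sigma> > 0"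
    and x_pos: "x > 0"
    and k_ge: "real k \<ge> of_int \<lceil>x^2 / 2\<rceil>"
    and xis: "\<xi>s = (sqrt 2 + 1)^2 * real k / real n"
    and xis_lt: "\<xi>s < 1"
    and v_pos: "v > 0"
    and c1: "exp 1 / 6 * rho2 (distr M borel (X 1)) (1 / (36 * v^2) * (real k / real n)) \<le> v"
    and c2: "(sqrt 2 + 1) * rho2 (distr M borel (X 1)) \<xi>s \<le> v"
  shows "measure M {\<omega> \<in> space M.
           \<bar>trimmed_mean k (map (\<lambda>i. X i \<omega>) [1..<n+1]) - \<mu>\<bar>
             > \<sigma> * (x + hfun \<xi>s v * sqrt (2 * real k)) / sqrt (real n)}
         \<le> 2 * exp (- (x^2 / 2)) + 2 * exp (- real k)"
proof -
  interpret prob_space M by fact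
  have X1[measurable]: "X 1 \<in> borel_measurable M"
    using rv n_pos by simp
  define D where "D = distr M borel (X 1)"
  have D: "prob_space D" "sets D = sets borel"
    unfolding D_def using X1 by (auto intro: prob_space_distr)
  have dist: "expectation (\<lambda>\<omega>. f (X i \<omega>)) = (\<integral>y. f y \<partial>D)"
    if "i \<in> {1..n}" "f \<in> borel_measurable borel" for f :: "real \<Rightarrow> real" and i
    using that rv[OF that(1)] ident[OF that(1)] by (metis D_def integral_distr)
  have one: "1 \<in> {1..n}" using n_pos by simp
  have \<mu>: "\<mu> = (\<integral>y. y \<partial>D)"
    using dist[OF one, of "\<lambda>y. y"] by (simp add: mu)
  have \<sigma>: "\<sigma> = sqrt (\<integral>y. (y - \<mu>)\<^sup>2 \<partial>D)"
    using dist[OF one, of "\<lambda>y. (y - \<mu>)\<^sup>2"] by (simp add: sigma mu)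
  have int1': "integrable D (\<lambda>y. y)"
    unfolding D_def using int1 by (simp add: integrable_distr_eq)
  have "integrable M (\<lambda>\<omega>. (X 1 \<omega> - \<mu>)\<^sup>2)"
    using int1 int2 by (simp add: power2_diff)
  then have int2': "integrable D (\<lambda>y. (y - \<mu>)\<^sup>2)"
    unfolding D_def by (subst integrable_distr_eq[OF X1]) measurable
  have xk: "x\<^sup>2 / 2 \<le> real k"
    using k_ge le_of_int_ceiling order_trans by blast
  then have k: "0 < real k"
    using x_pos by (smt (verit) half_gt_zero zero_less_power)
  have n: "0 < real n" using n_pos by simp
  define s2 :: real where "s2 = sqrt 2 + 1"
  have s2: "2 < s2" "0 < s2" by (simp_all add: s2_def add_pos_pos)
  define r where "r = sqrt (real k / real n)"
  have r: "0 < r" "r\<^sup>2 = real k / real n"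
    using k n by (simp_all add: r_def)
  have \<xi>: "\<xi>s = s2\<^sup>2 * r\<^sup>2" "0 < \<xi>s"
    using s2 r k n by (simp_all add: xis s2_def)
  define W where "W = \<sigma> * v / s2"
  have W: "0 < W" using sigma_pos v_pos s2 by (simp add: W_def)
  \<comment> \<open>The factor \<open>exp 1\<close> makes the Chebyshev bound
    \<open>W\<^sup>2 / t\<^sup>2\<close> equal to \<open>exp (- 2) * k / n\<close>, exactly what the
    count of outliers requires.\<close>
  define t where "t = exp 1 * W / r"
  have t: "0 < t" using W r by (simp add: t_def)
  have rho: "\<sigma> * rho2 D \<xi>s \<le> W"
  proof -
    have "s2 * rho2 D \<xi>s \<le> v"
      using c2 unfolding D_def s2_def .
    then show ?thesis
      using s2 sigma_pos by (simp add: W_def field_simps)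
  qed
  have t_sq: "t\<^sup>2 = exp 2 * W\<^sup>2 / r\<^sup>2"
    by (simp add: t_def power_divide power_mult_distrib flip: exp_of_nat_mult)
  have large: "W\<^sup>2 < t\<^sup>2 * \<xi>s"
  proof -
    have "1 < exp (2::real)" by simp
    moreover have "1 < s2\<^sup>2" using s2 by (intro one_less_power) auto
    ultimately have "1 < exp 2 * s2\<^sup>2" by (rule less_1_mult)
    then show ?thesis using W r(1) by (simp add: t_sq \<xi>(1))
  qed
  define E where "E = {y. t < \<bar>y - \<mu>\<bar>}"
  have E[measurable]: "E \<in> sets borel" unfolding E_def by measurable
  note tails = tail_bounds[OF D \<mu> \<sigma> sigma_pos int2' \<xi>(2) rho t large]
  define Y where "Y i \<omega> = clip t (X i \<omega> - \<mu>)" for i \<omega>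
  define m where "m = (\<integral>y. clip t (y - \<mu>) \<partial>D)"
  have "\<bar>m\<bar> \<le> W\<^sup>2 / t"
    using clip_mean_bound[OF D \<mu> int1' int2' t] divide_right_mono[OF tails(1), of t] t
    unfolding m_def by linarith
  then have m: "\<bar>m\<bar> \<le> W * r / exp 1"
    using W r by (simp add: t_def power2_eq_square)
  have indY: "indep_vars (\<lambda>_. borel) Y {1..n}"
    unfolding Y_def by (rule indep_vars_compose2[OF indep]) measurable
  \<comment> \<open>The lower tail comes from Bernstein's inequality for \<open>- Y\<close>, with
    mean \<open>- m\<close>.\<close>
  have indY': "indep_vars (\<lambda>_. borel) (\<lambda>i \<omega>. - Y i \<omega>) {1..n}"
    by (rule indep_vars_compose2[OF indY]) measurable
  have Y_le: "\<bar>Y i \<omega>\<bar> \<le> t" for i \<omega>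
    using t by (simp add: Y_def abs_clip_le)
  have Ym: "expectation (Y i) = m" if "i \<in> {1..n}" for i
    using dist[OF that, of "\<lambda>y. clip t (y - \<mu>)"] by (simp add: Y_def[abs_def] m_def)
  have Y2: "expectation (\<lambda>\<omega>. (Y i \<omega>)\<^sup>2) \<le> \<sigma>\<^sup>2" if "i \<in> {1..n}" for i
  proof -
    have "expectation (\<lambda>\<omega>. (Y i \<omega>)\<^sup>2) = (\<integral>y. (clip t (y - \<mu>))\<^sup>2 \<partial>D)"
      using dist[OF that, of "\<lambda>y. (clip t (y - \<mu>))\<^sup>2"] by (simp add: Y_def)
    also have "\<dots> \<le> (\<integral>y. (y - \<mu>)\<^sup>2 \<partial>D)"
      using t by (intro integral_mono' int2') (auto simp: clip_def simp flip: abs_le_square_iff)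
    also have "\<dots> = \<sigma>\<^sup>2"
      by (simp add: \<sigma>)
    finally show ?thesis .
  qed
  define a where "a = x * \<sigma> * sqrt n + t * x\<^sup>2 / 6"
  define B1 where "B1 = {\<omega> \<in> space M. real n * m + a \<le> (\<Sum>i\<in>{1..n}. Y i \<omega>)}"
  define B2 where "B2 = {\<omega> \<in> space M. real n * (- m) + a \<le> (\<Sum>i\<in>{1..n}. - Y i \<omega>)}"
  define B3 where "B3 = {\<omega> \<in> space M. real k \<le> (\<Sum>i\<in>{1..n}. indicator E (X i \<omega>))}"
  have B1: "prob B1 \<le> exp (- (x\<^sup>2 / 2))"
    using Bernstein_sum_ge[OF _ _ indY Y_le Ym Y2 t sigma_pos x_pos] n_pos
    by (simp add: B1_def a_def add.assoc)
  have B2: "prob B2 \<le> exp (- (x\<^sup>2 / 2))"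
    using Bernstein_sum_ge[OF _ _ indY', of t "- m" \<sigma> x] Y_le Ym Y2 t sigma_pos x_pos n_pos
    by (simp add: B2_def a_def algebra_simps)
  have B3: "prob B3 \<le> exp (- real k)"
    unfolding B3_def
  proof (rule prob_many_events_le[OF _ indep E])
    fix i assume i: "i \<in> {1..n}"
    have "prob {\<omega> \<in> space M. X i \<omega> \<in> E} = measure (distr M borel (X i)) E"
      using rv[OF i] E by (subst measure_distr) (auto intro!: arg_cong[where f = prob])
    then show "prob {\<omega> \<in> space M. X i \<omega> \<in> E} \<le> measure D E"
      using ident[OF i] by (simp add: D_def)
  next
    have "W\<^sup>2 * (exp 2 * measure D E) \<le> W\<^sup>2 * r\<^sup>2"
      using tails(2) r(1) by (simp add: t_sq E_def field_simps)
    then have "exp 2 * measure D E \<le> r\<^sup>2"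
      using W by simp
    then have "measure D E \<le> exp (- 2) * r\<^sup>2"
      by (simp add: exp_minus field_simps)
    then show "real (card {1..n}) * measure D E \<le> exp (- 2) * real k"
      using n by (simp add: r(2) field_simps)
  qed simp
  have meas: "B1 \<in> events" "B2 \<in> events" "B3 \<in> events"
  proof -
    note rv[measurable]
    show "B1 \<in> events" "B2 \<in> events" "B3 \<in> events"
      unfolding B1_def B2_def B3_def Y_def by measurable
  qed
  \<comment> \<open>Since \<open>s2 > 2\<close>, the condition \<open>\<xi>s < 1\<close> even gives
    \<open>4 * k < n\<close>, so the natural-number difference \<open>n - 2 * k\<close> is not
    truncated.\<close>
  have two_k: "2 * k \<le> n"
  proof -
    have "real k * 4 \<le> real k * s2\<^sup>2"
      using s2 power_mono[of 2 s2 2] by (intro mult_left_mono) auto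
    also have "\<dots> < real n"
      using xis_lt n by (simp add: xis s2_def field_simps)
    finally show ?thesis by linarith
  qed
  have subset: "{\<omega> \<in> space M. \<bar>trimmed_mean k (map (\<lambda>i. X i \<omega>) [1..<n+1]) - \<mu>\<bar>
       > \<sigma> * (x + hfun \<xi>s v * sqrt (2 * real k)) / sqrt (real n)} \<subseteq> B1 \<union> B2 \<union> B3"
  proof (intro subsetI, rule ccontr)
    fix \<omega>
    assume "\<omega> \<in> {\<omega> \<in> space M. \<bar>trimmed_mean k (map (\<lambda>i. X i \<omega>) [1..<n+1]) - \<mu>\<bar>
       > \<sigma> * (x + hfun \<xi>s v * sqrt (2 * real k)) / sqrt (real n)}"
    then have \<omega>: "\<omega> \<in> space M" and dev: "\<sigma> * (x + hfun \<xi>s v * sqrt (2 * real k)) / sqrt (real n)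
        < \<bar>trimmed_mean k (map (\<lambda>i. X i \<omega>) [1..<n+1]) - \<mu>\<bar>" by auto
    assume "\<omega> \<notin> B1 \<union> B2 \<union> B3"
    then have sums: "\<bar>\<Sum>i\<in>{1..n}. Y i \<omega>\<bar> \<le> real n * \<bar>m\<bar> + a"
      and few: "(\<Sum>i\<in>{1..n}. indicator E (X i \<omega>)) < real k"
      using \<omega> mult_left_mono[OF abs_ge_self[of m], of "real n"]
        mult_left_mono[OF abs_ge_minus_self[of m], of "real n"]
      by (auto simp: B1_def B2_def B3_def sum_negf)
    define xs where "xs = map (\<lambda>i. X i \<omega>) [1..<n+1]"
    have len: "length xs = n" by (simp add: xs_def)
    have sum_xs: "(\<Sum>y\<leftarrow>xs. f y) = (\<Sum>i\<in>{1..n}. f (X i \<omega>))" for f :: "real \<Rightarrow> real"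
      unfolding xs_def by (simp add: interv_sum_list_conv_sum_set_nat comp_def atLeastLessThanSuc_atLeastAtMost
          del: upt_Suc)
    have "real (length (filter (\<lambda>y. t < \<bar>y - \<mu>\<bar>) ys)) = (\<Sum>y\<leftarrow>ys. indicator E y)" for ys
      by (induction ys) (auto simp: E_def indicator_def)
    then have "real (length (filter (\<lambda>y. t < \<bar>y - \<mu>\<bar>) xs)) < real k"
      using few by (simp only: sum_xs)
    then have "length (filter (\<lambda>y. t < \<bar>y - \<mu>\<bar>) xs) < k"
      by simp
    from trimmed_sum_deviation[OF _ less_imp_le[OF t] this]
    have mid: "\<bar>sum_list (take (n - 2 * k) (drop k (sort xs))) - real (n - 2 * k) * \<mu>\<bar>
        \<le> real n * \<bar>m\<bar> + a + real k * t"
      using sums two_k by (simp add: len sum_xs Y_def)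
    define N where "N = real (n - 2 * k)"
    \<comment> \<open>Trimming removes the fraction \<open>2 * k / n\<close>, which is below
      \<open>\<xi>s\<close> because \<open>s2\<^sup>2\<close> exceeds 2.\<close>
    have N_ge: "real n * (1 - \<xi>s) \<le> N"
    proof -
      have "real k * 2 \<le> real k * s2\<^sup>2"
        using s2 power_mono[of 2 s2 2] by (intro mult_left_mono) auto
      moreover have "real n * \<xi>s = real k * s2\<^sup>2"
        using n by (simp add: xis s2_def)
      ultimately show ?thesis
        using two_k by (simp add: N_def of_nat_diff right_diff_distrib)
    qed
    have N: "0 < N"
      using N_ge n xis_lt by (smt (verit) mult_pos_pos)
    have "\<bar>trimmed_mean k xs - \<mu>\<bar> = \<bar>sum_list (take (n - 2 * k) (drop k (sort xs))) - N * \<mu>\<bar> / N"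
    proof -
      have "trimmed_mean k xs - \<mu> = (sum_list (take (n - 2 * k) (drop k (sort xs))) - N * \<mu>) / N"
        using N unfolding trimmed_mean_def len N_def[symmetric] by (simp add: diff_divide_distrib)
      then show ?thesis using N by simp
    qed
    also have "\<dots> \<le> (real n * \<bar>m\<bar> + a + real k * t) / N"
      using mid N by (intro divide_right_mono) (auto simp: N_def)
    also have "\<dots> \<le> \<sigma> * (x + hfun \<xi>s v * sqrt (2 * real k)) / sqrt (real n)"
    proof (rule deviation_budget[OF _ xis_lt N_ge n])
      show "x \<le> sqrt (2 * real k)"
        using xk by (intro real_le_rsqrt) simp
      have kt: "real k * t = real n * W * r * exp 1"
      proof -
        have "real k = real n * r\<^sup>2" using n by (simp add: r(2))
        then show ?thesis using r(1) by (simp add: t_def power2_eq_square)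
      qed
      \<comment> \<open>Here \<open>x\<^sup>2 \<le> 2 * k\<close> turns Bernstein's linear term into
        a third of the trimming cost \<open>k * t\<close>.\<close>
      have "t * x\<^sup>2 / 6 \<le> real k * t / 3"
        using xk t by (simp add: field_simps)
      moreover have "real n * \<bar>m\<bar> \<le> real n * (W * r / exp 1)"
        using m n by (intro mult_left_mono) auto
      ultimately have "real n * \<bar>m\<bar> + a + real k * t
          \<le> x * \<sigma> * sqrt n + real n * (W * r / exp 1) + 4 / 3 * (real k * t)"
        by (simp add: a_def)
      also have "\<dots> = x * \<sigma> * sqrt n + real n * W * r * (1 / exp 1 + 4 / 3 * exp 1)"
        unfolding kt by (simp add: algebra_simps)
      also have "\<dots> \<le> x * \<sigma> * sqrt n + real n * W * r * (2 * s2)"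
        using exp_constant_bound n W r unfolding s2_def
        by (intro add_left_mono mult_left_mono) auto
      also have "real n * W * r * (2 * s2) = 2 * real n * \<sigma> * v * r"
        using s2 by (simp add: W_def)
      finally show "real n * \<bar>m\<bar> + a + real k * t
          \<le> x * \<sigma> * sqrt n + 2 * real n * \<sigma> * v * sqrt (real k / real n)"
        by (simp add: r_def)
    qed (use \<xi> k sigma_pos v_pos x_pos in auto)
    finally show False
      using dev by (simp add: xs_def)
  qed
  have "measure M {\<omega> \<in> space M. \<bar>trimmed_mean k (map (\<lambda>i. X i \<omega>) [1..<n+1]) - \<mu>\<bar>
       > \<sigma> * (x + hfun \<xi>s v * sqrt (2 * real k)) / sqrt (real n)} \<le> prob (B1 \<union> B2 \<union> B3)"
    using meas by (intro finite_measure_mono subset) auto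
  also have "\<dots> \<le> prob B1 + prob B2 + prob B3"
    using meas measure_Un_le[of "B1 \<union> B2" M B3] measure_Un_le[of B1 M B2] by auto
  \<comment> \<open>\<open>B3\<close> counts the outliers of both sides together, so a single
    \<open>exp (- real k)\<close> bounds it.\<close>
  also have "\<dots> \<le> 2 * exp (- (x^2 / 2)) + 2 * exp (- real k)"
    using B1 B2 B3 exp_ge_zero[of "- real k"] by linarith
  finally show ?thesis .
qed

end
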